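(* Let $(X_k)_{k\in\mathbb{Z}}$ be an $L_2$-stationary sequence of square-integrable real random variables with $E(X_k)=0$ and $E(X_k^2)=1$. Let $\rho=\mathrm{corr}(X_0,X_1)$ and $r_2=\mathrm{corr}(X_0,X_2)$, and assume $\rho\ne0$ and $r_2+1-2|\rho|>0$. Suppose there are real constants $a,b,A,B,C,D$ such that for all $k\in\mathbb{Z}$ $$E(X_k\mid \dots,X_{k-2},X_{k-1},X_{k+1},X_{k+2},\dots)=a(X_{k-1}+X_{k+1})+b,$$ $$E(X_k^2\mid \dots,X_{k-2},X_{k-1},X_{k+1},X_{k+2},\dots)=A(X_{k-1}^2+X_{k+1}^2)+BX_{k-1}X_{k+1}+C+D(X_{k-1}+X_{k+1}),$$ and that $A<1/(1+\rho^2)$. If $A\left(\rho^2+\frac{1}{\rho^2}\right)+B<1$, then $X_0$ is bounded. If $A\left(\rho^2+\frac{1}{\rho^2}\right)+B=1$ and $D\neq0$, then $X_0$ is bounded from below when $D>0$, and bounded from above when $D<0$.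
   Context: $L_2$-stationary means that the variables are square-integrable, $E(X_k)$ does not depend on $k$, and $E(X_kX_{k+j})$ does not depend on $k$ for each $j$. The conditional expectations are given the $\sigma$-field generated by $\{X_j: j\ne k\}$, with equalities almost surely. Boundedness of a random variable (from below, from above) is understood almost surely, i.e. by a deterministic constant with probability one. *)

theory Defs
  imports "HOL-Probability.Probability"
begin

definition covariance :: "'a measure \<Rightarrow> ('a \<Rightarrow> real) \<Rightarrow> ('a \<Rightarrow> real) \<Rightarrow> real" where
  "covariance M X Y =
     (LINT \<omega>|M. (X \<omega> - (LINT \<omega>'|M. X \<omega>')) * (Y \<omega> - (LINT \<omega>'|M. Y \<omega>')))"

definition correlation :: "'a measure \<Rightarrow> ('a \<Rightarrow> real) \<Rightarrow> ('a \<Rightarrow> real) \<Rightarrow> real" where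
  "correlation M X Y = covariance M X Y / sqrt (covariance M X X * covariance M Y Y)"

definition L2_stationary :: "'a measure \<Rightarrow> (int \<Rightarrow> 'a \<Rightarrow> real) \<Rightarrow> bool" where
  "L2_stationary M X \<longleftrightarrow>
     (\<forall>k. X k \<in> borel_measurable M \<and> integrable M (\<lambda>\<omega>. (X k \<omega>)\<^sup>2)) \<and>
     (\<forall>k l. (LINT \<omega>|M. X k \<omega>) = (LINT \<omega>|M. X l \<omega>)) \<and>
     (\<forall>j k l. (LINT \<omega>|M. X k \<omega> * X (k + j) \<omega>) = (LINT \<omega>|M. X l \<omega> * X (l + j) \<omega>))"

(* The sigma-field generated by {X j. j \<noteq> k}.  It is encoded as a measure only to carry the
   sigma-field, as real_cond_exp expects; its measure component is irrelevant. *)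
definition sigma_others :: "'a measure \<Rightarrow> (int \<Rightarrow> 'a \<Rightarrow> real) \<Rightarrow> int \<Rightarrow> 'a measure" where
  "sigma_others M X k =
     sigma (space M) {X j -` S \<inter> space M | j S. j \<noteq> k \<and> S \<in> sets borel}"

definition AE_bounded_below :: "'a measure \<Rightarrow> ('a \<Rightarrow> real) \<Rightarrow> bool" where
  "AE_bounded_below M Y \<longleftrightarrow> (\<exists>K. AE \<omega> in M. K \<le> Y \<omega>)"

definition AE_bounded_above :: "'a measure \<Rightarrow> ('a \<Rightarrow> real) \<Rightarrow> bool" where
  "AE_bounded_above M Y \<longleftrightarrow> (\<exists>K. AE \<omega> in M. Y \<omega> \<le> K)"

definition AE_bounded :: "'a measure \<Rightarrow> ('a \<Rightarrow> real) \<Rightarrow> bool" where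
  "AE_bounded M Y \<longleftrightarrow> (\<exists>K. AE \<omega> in M. \<bar>Y \<omega>\<bar> \<le> K)"

end

theory Submission
  imports Defs
begin

text \<open>
  The coefficient \<open>a\<close> satisfies \<open>0 < \<bar>a\<bar> < 1/2\<close>, because the linear regression forces
  \<open>\<rho> = a (1 + r2)\<close>; so \<open>a = x / (1 + x\<^sup>2)\<close> for some \<open>x\<close> with \<open>0 < \<bar>x\<bar> < 1\<close>. Write
  \<open>E\<^sub>m\<close> for conditional expectation given the past \<open>(X\<^sub>j)\<^bsub>j \<le> m\<^esub>\<close>. Conditioning the two-sided
  regression on the past shows that \<open>Y\<^sub>k = E\<^sub>m X\<^bsub>m+k\<^esub>\<close> solves
  \<open>Y\<^bsub>k+1\<^esub> = a (Y\<^sub>k + Y\<^bsub>k+2\<^esub>)\<close>, whose solutions combine \<open>x\<^sup>k\<close> and \<open>x\<^bsup>-k\<^esup>\<close>; boundedness in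
  \<open>L\<^sub>1\<close> excludes the growing one (\<open>L1_bounded_recurrence\<close>). Hence \<open>E\<^sub>m X\<^bsub>m+k\<^esub> = x\<^sup>k X\<^sub>m\<close>,
  and in particular \<open>x = \<rho>\<close>.

  The product \<open>X\<^bsub>m+1\<^esub> X\<^bsub>m+2\<^esub>\<close> can be conditioned in two ways: by predicting
  \<open>X\<^bsub>m+2\<^esub>\<close> from the past up to \<open>m + 1\<close>, or by interpolating \<open>X\<^bsub>m+1\<^esub>\<close> between its neighbours.
  Comparing the results expresses \<open>E\<^sub>m X\<^bsub>m+2\<^esub>\<^sup>2\<close> through \<open>E\<^sub>m X\<^bsub>m+1\<^esub>\<^sup>2\<close> and
  \<open>X\<^sub>m\<^sup>2\<close> (\<open>second_moment_two_step\<close>). The quadratic regression, conditioned on the past, then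
  becomes a linear equation for \<open>E\<^sub>m X\<^bsub>m+1\<^esub>\<^sup>2\<close>:
  \<open>(1 - A (1 + \<rho>\<^sup>2)) E\<^sub>m X\<^bsub>m+1\<^esub>\<^sup>2 = (A (1 - \<rho>\<^sup>2) + B \<rho>\<^sup>2) X\<^sub>m\<^sup>2 + D (1 + \<rho>\<^sup>2) X\<^sub>m + C\<close>.

  The factor on the left is positive, and conditional variances are nonnegative:
  \<open>E\<^sub>m X\<^bsub>m+1\<^esub>\<^sup>2 \<ge> \<rho>\<^sup>2 X\<^sub>m\<^sup>2\<close>. The result (\<open>quadratic_constraint\<close>) is that almost surely
  \<open>\<rho>\<^sup>2 (A (\<rho>\<^sup>2 + 1/\<rho>\<^sup>2) + B - 1) X\<^sub>m\<^sup>2 + D (1 + \<rho>\<^sup>2) X\<^sub>m + C \<ge> 0\<close>. A quadratic polynomial with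
  negative leading coefficient is nonnegative only on a bounded set, and if the leading
  coefficient vanishes, a half-line bounded on the side given by the sign of \<open>D\<close> remains.
\<close>

section \<open>Conditional expectations along nested sigma-fields\<close>

lemma (in finite_measure) sigma_finite_subalgebraI:
  assumes "subalgebra M F"
  shows "sigma_finite_subalgebra M F"
  using assms
  by (intro finite_measure_subalgebra_is_sigma_finite)
     (simp add: finite_measure_subalgebra_def finite_measure_subalgebra_axioms_def finite_measure_axioms)

lemma integrable_product_of_squares:
  fixes f g :: "'a \<Rightarrow> real"
  assumes [measurable]: "f \<in> borel_measurable M" "g \<in> borel_measurable M"
    and "integrable M (\<lambda>\<omega>. (f \<omega>)\<^sup>2)" "integrable M (\<lambda>\<omega>. (g \<omega>)\<^sup>2)"
  shows "integrable M (\<lambda>\<omega>. f \<omega> * g \<omega>)"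
proof (rule Bochner_Integration.integrable_bound)
  show "integrable M (\<lambda>\<omega>. (f \<omega>)\<^sup>2 + (g \<omega>)\<^sup>2)"
    using assms by simp
  have "\<bar>u * v\<bar> \<le> u\<^sup>2 + v\<^sup>2" for u v :: real
  proof -
    have "0 \<le> (\<bar>u\<bar> - \<bar>v\<bar>)\<^sup>2" "0 \<le> \<bar>u\<bar> * \<bar>v\<bar>" by simp_all
    then show ?thesis unfolding power2_diff abs_mult power2_abs by linarith
  qed
  then show "AE \<omega> in M. norm (f \<omega> * g \<omega>) \<le> norm ((f \<omega>)\<^sup>2 + (g \<omega>)\<^sup>2)"
    by (simp add: order_trans)
qed measurable

text \<open>How a regression with respect to a finer sigma-field is used under a coarser one: condition on
  \<open>H\<close> first, where the \<open>H\<close>-measurable factor \<open>W\<close> comes out, and then on \<open>F\<close>.\<close>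

lemma (in finite_measure) real_cond_exp_tower_pull_out:
  assumes H: "subalgebra M H" and F: "subalgebra H F"
    and W: "W \<in> borel_measurable H" and [measurable]: "Z \<in> borel_measurable M" "g \<in> borel_measurable M"
    and int: "integrable M (\<lambda>\<omega>. W \<omega> * Z \<omega>)"
    and g: "AE \<omega> in M. real_cond_exp M H Z \<omega> = g \<omega>"
  shows "AE \<omega> in M. real_cond_exp M F (\<lambda>\<omega>. W \<omega> * Z \<omega>) \<omega> = real_cond_exp M F (\<lambda>\<omega>. W \<omega> * g \<omega>) \<omega>"
proof -
  have MF: "subalgebra M F"
    using H F by (auto simp: subalgebra_def)
  interpret H: sigma_finite_subalgebra M H by (rule sigma_finite_subalgebraI[OF H])
  interpret F: sigma_finite_subalgebra M F by (rule sigma_finite_subalgebraI[OF MF])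
  have [measurable]: "W \<in> borel_measurable M"
    by (rule measurable_from_subalg[OF H W])
  have "AE \<omega> in M. real_cond_exp M H (\<lambda>\<omega>. W \<omega> * Z \<omega>) \<omega> = W \<omega> * g \<omega>"
    using H.real_cond_exp_mult[OF W _ int] g by auto
  then have "AE \<omega> in M. real_cond_exp M F (real_cond_exp M H (\<lambda>\<omega>. W \<omega> * Z \<omega>)) \<omega>
      = real_cond_exp M F (\<lambda>\<omega>. W \<omega> * g \<omega>) \<omega>"
    by (rule F.real_cond_exp_cong) auto
  then show ?thesis
    using F.real_cond_exp_nested_subalg[OF H F int] by auto
qed

text \<open>Second-order expressions in a known variable and a single future variable \<open>Z\<close> have this shape,
  as do the right-hand side of the quadratic regression and the square of a prediction error.\<close>

lemma (in finite_measure) real_cond_exp_quadratic: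
  assumes F: "subalgebra M F"
    and U: "U \<in> borel_measurable F" "integrable M U"
    and V: "V \<in> borel_measurable F" "integrable M (\<lambda>\<omega>. V \<omega> * Z \<omega>)"
    and Z: "Z \<in> borel_measurable M" "integrable M (\<lambda>\<omega>. (Z \<omega>)\<^sup>2)"
  shows "AE \<omega> in M. real_cond_exp M F (\<lambda>\<omega>. U \<omega> + (V \<omega> * Z \<omega> + c * (Z \<omega>)\<^sup>2)) \<omega>
      = U \<omega> + (V \<omega> * real_cond_exp M F Z \<omega> + c * real_cond_exp M F (\<lambda>\<omega>. (Z \<omega>)\<^sup>2) \<omega>)"
proof -
  interpret F: sigma_finite_subalgebra M F by (rule sigma_finite_subalgebraI[OF F])
  show ?thesis
    using F.real_cond_exp_add[of U "\<lambda>\<omega>. V \<omega> * Z \<omega> + c * (Z \<omega>)\<^sup>2"] U V Z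
      F.real_cond_exp_add[of "\<lambda>\<omega>. V \<omega> * Z \<omega>" "\<lambda>\<omega>. c * (Z \<omega>)\<^sup>2"]
      F.real_cond_exp_F_meas[of U] F.real_cond_exp_mult[of V Z]
      F.real_cond_exp_cmult[of "\<lambda>\<omega>. (Z \<omega>)\<^sup>2" c]
    by (simp, fastforce)
qed

lemma (in finite_measure) integral_abs_real_cond_exp_le:
  assumes F: "subalgebra M F" and f: "integrable M f"
  shows "(LINT \<omega>|M. \<bar>real_cond_exp M F f \<omega>\<bar>) \<le> (LINT \<omega>|M. \<bar>f \<omega>\<bar>)"
proof -
  interpret F: sigma_finite_subalgebra M F by (rule sigma_finite_subalgebraI[OF F])
  have af: "integrable M (\<lambda>\<omega>. \<bar>f \<omega>\<bar>)" using f by simp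
  have "AE \<omega> in M. \<bar>real_cond_exp M F f \<omega>\<bar> \<le> real_cond_exp M F (\<lambda>\<omega>. \<bar>f \<omega>\<bar>) \<omega>"
    using F.real_cond_exp_mono[of f "\<lambda>\<omega>. \<bar>f \<omega>\<bar>"] F.real_cond_exp_mono[of "\<lambda>\<omega>. -1 * f \<omega>" "\<lambda>\<omega>. \<bar>f \<omega>\<bar>"]
      F.real_cond_exp_cmult[of f "-1"] f af by (auto simp: abs_le_iff)
  then have "(LINT \<omega>|M. \<bar>real_cond_exp M F f \<omega>\<bar>) \<le> (LINT \<omega>|M. real_cond_exp M F (\<lambda>\<omega>. \<bar>f \<omega>\<bar>) \<omega>)"
    using F.real_cond_exp_int(1)[OF f] F.real_cond_exp_int(1)[OF af] by (intro integral_mono_AE) auto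
  then show ?thesis using F.real_cond_exp_int(2)[OF af] by simp
qed

section \<open>Bounded solutions of the two-sided recurrence\<close>

text \<open>The two roots of \<open>a t\<^sup>2 - t + a = 0\<close> have product 1 and are real and distinct when
  \<open>0 < \<bar>a\<bar> < 1/2\<close>, so that exactly one of them has modulus below 1.\<close>

lemma small_root_exists:
  fixes a :: real
  assumes "a \<noteq> 0" "\<bar>a\<bar> < 1 / 2"
  obtains x where "x \<noteq> 0" "\<bar>x\<bar> < 1" "a = x / (1 + x\<^sup>2)"
proof
  define s where "s = sqrt (1 - 4 * a\<^sup>2)"
  have "\<bar>a\<bar>\<^sup>2 \<le> (1 / 2)\<^sup>2" using assms by (intro power_mono) auto
  then have le: "4 * a\<^sup>2 \<le> 1" by (simp add: power2_eq_square)
  then have s: "0 \<le> s" "s\<^sup>2 = 1 - 4 * a\<^sup>2" by (auto simp: s_def)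
  \<comment> \<open>the smaller root \<open>(1 - s) / (2 a)\<close>, rationalised so that \<open>\<bar>x\<bar> < 1\<close> is evident\<close>
  define x where "x = 2 * a / (1 + s)"
  show "x \<noteq> 0" using assms s by (simp add: x_def)
  show "\<bar>x\<bar> < 1" using assms s by (simp add: x_def abs_divide)
  have "x\<^sup>2 = ((1 - s) * (1 + s)) / ((1 + s) * (1 + s))"
    using s(2) by (simp add: x_def power_divide power2_eq_square algebra_simps)
  also have "\<dots> = (1 - s) / (1 + s)" using s(1) by simp
  finally have "1 + x\<^sup>2 = 2 / (1 + s)" using s(1) by (simp add: field_simps)
  then show "a = x / (1 + x\<^sup>2)" using s by (simp add: x_def)
qed

text \<open>The defect \<open>Y\<^bsub>k+1\<^esub> - x Y\<^sub>k\<close> carries the growing part of the solution: by the recurrence it is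
  multiplied by \<open>1 / x\<close> in each step. As its \<open>L\<^sub>1\<close> norm stays bounded, the initial defect has
  norm at most a constant times \<open>\<bar>x\<bar>\<^sup>k\<close> for every \<open>k\<close>, hence vanishes.\<close>

lemma (in finite_measure) L1_bounded_recurrence:
  fixes Y :: "nat \<Rightarrow> 'a \<Rightarrow> real" and x K :: real
  assumes x: "x \<noteq> 0" "\<bar>x\<bar> < 1"
    and int: "\<And>k. integrable M (Y k)" and K: "\<And>k. (LINT \<omega>|M. \<bar>Y k \<omega>\<bar>) \<le> K"
    and rec: "\<And>k. AE \<omega> in M. Y (Suc k) \<omega> = x / (1 + x\<^sup>2) * (Y k \<omega> + Y (Suc (Suc k)) \<omega>)"
  shows "AE \<omega> in M. Y 1 \<omega> = x * Y 0 \<omega>"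
proof -
  define \<delta> where "\<delta> \<omega> = Y 1 \<omega> - x * Y 0 \<omega>" for \<omega>
  have int\<delta>: "integrable M \<delta>" unfolding \<delta>_def using int by simp
  have "1 + x\<^sup>2 > 0" by (simp add: add_pos_nonneg)
  have step: "AE \<omega> in M. \<delta> \<omega> = x ^ k * (Y (Suc k) \<omega> - x * Y k \<omega>)" for k
  proof (induction k)
    case 0
    then show ?case by (simp add: \<delta>_def)
  next
    case (Suc k)
    from Suc.IH rec[of k] show ?case
    proof eventually_elim
      case (elim \<omega>)
      have "(1 + x\<^sup>2) * Y (Suc k) \<omega> = x * (Y k \<omega> + Y (Suc (Suc k)) \<omega>)"
        using elim(2) \<open>1 + x\<^sup>2 > 0\<close> by simp
      then have "Y (Suc k) \<omega> - x * Y k \<omega> = x * (Y (Suc (Suc k)) \<omega> - x * Y (Suc k) \<omega>)"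
        by (simp add: algebra_simps power2_eq_square)
      then show ?case using elim(1) by simp
    qed
  qed
  have bound: "(LINT \<omega>|M. \<bar>\<delta> \<omega>\<bar>) \<le> \<bar>x\<bar> ^ k * (2 * K)" for k
  proof -
    have "(LINT \<omega>|M. \<bar>\<delta> \<omega>\<bar>) \<le> (LINT \<omega>|M. \<bar>x\<bar> ^ k * (\<bar>Y (Suc k) \<omega>\<bar> + \<bar>Y k \<omega>\<bar>))"
    proof (rule integral_mono_AE)
      show "AE \<omega> in M. \<bar>\<delta> \<omega>\<bar> \<le> \<bar>x\<bar> ^ k * (\<bar>Y (Suc k) \<omega>\<bar> + \<bar>Y k \<omega>\<bar>)"
        using step[of k]
      proof eventually_elim
        case (elim \<omega>)
        have "\<bar>x * Y k \<omega>\<bar> \<le> \<bar>Y k \<omega>\<bar>"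
          using x by (simp add: abs_mult mult_left_le_one_le)
        then have "\<bar>Y (Suc k) \<omega> - x * Y k \<omega>\<bar> \<le> \<bar>Y (Suc k) \<omega>\<bar> + \<bar>Y k \<omega>\<bar>" by linarith
        then show ?case
          unfolding elim by (simp add: abs_mult power_abs mult_left_mono)
      qed
    qed (use int int\<delta> in auto)
    also have "\<dots> = \<bar>x\<bar> ^ k * ((LINT \<omega>|M. \<bar>Y (Suc k) \<omega>\<bar>) + (LINT \<omega>|M. \<bar>Y k \<omega>\<bar>))"
      using int by simp
    also have "\<dots> \<le> \<bar>x\<bar> ^ k * (2 * K)"
      using K[of k] K[of "Suc k"] by (intro mult_left_mono) auto
    finally show ?thesis .
  qed
  have "(\<lambda>k. \<bar>x\<bar> ^ k * (2 * K)) \<longlonglongrightarrow> 0 * (2 * K)"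
    using x by (intro tendsto_intros LIMSEQ_power_zero) auto
  then have "(LINT \<omega>|M. \<bar>\<delta> \<omega>\<bar>) \<le> 0 * (2 * K)"
    by (rule LIMSEQ_le_const) (use bound in auto)
  moreover have "(LINT \<omega>|M. \<bar>\<delta> \<omega>\<bar>) \<ge> 0" by simp
  ultimately have "(LINT \<omega>|M. \<bar>\<delta> \<omega>\<bar>) = 0" by simp
  then have "AE \<omega> in M. \<bar>\<delta> \<omega>\<bar> = 0"
    using int\<delta> by (subst (asm) integral_nonneg_eq_0_iff_AE) auto
  then show ?thesis by (simp add: \<delta>_def)
qed

section \<open>From two-sided to one-sided regressions\<close>

text \<open>A common form for the two kinds of sigma-field in play, so that inclusions between
  them reduce to inclusions of index sets.\<close>

definition sigma_indexed :: "'a measure \<Rightarrow> (int \<Rightarrow> 'a \<Rightarrow> real) \<Rightarrow> int set \<Rightarrow> 'a measure" where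
  "sigma_indexed M X J =
     sigma (space M) {X j -` S \<inter> space M | j S. j \<in> J \<and> S \<in> sets borel}"

lemma sigma_others_eq: "sigma_others M X k = sigma_indexed M X (- {k})"
  by (simp add: sigma_others_def sigma_indexed_def)

lemma space_sigma_indexed [simp]: "space (sigma_indexed M X J) = space M"
  unfolding sigma_indexed_def by (rule space_measure_of) auto

lemma sets_sigma_indexed:
  "sets (sigma_indexed M X J)
     = sigma_sets (space M) {X j -` S \<inter> space M | j S. j \<in> J \<and> S \<in> sets borel}"
  unfolding sigma_indexed_def by (rule sets_measure_of) auto

lemma measurable_sigma_indexed:
  assumes "j \<in> J"
  shows "X j \<in> borel_measurable (sigma_indexed M X J)"
  by (rule measurableI) (use assms in \<open>auto simp: sets_sigma_indexed intro!: sigma_sets.Basic\<close>)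

lemma subalgebra_sigma_indexed_mono:
  assumes "I \<subseteq> J"
  shows "subalgebra (sigma_indexed M X J) (sigma_indexed M X I)"
  unfolding subalgebra_def sets_sigma_indexed space_sigma_indexed
  using assms by (intro conjI refl sigma_sets_mono') blast

lemma subalgebra_sigma_indexed:
  assumes "\<And>j. X j \<in> borel_measurable M"
  shows "subalgebra M (sigma_indexed M X J)"
  unfolding subalgebra_def sets_sigma_indexed space_sigma_indexed
  using assms by (intro conjI refl sets.sigma_sets_subset) (auto intro: measurable_sets)

text \<open>The linear regression, with its coefficient written through the ratio \<open>x\<close> of the decaying
  geometric solution and with zero intercept.\<close>

locale two_sided_linear_regression = prob_space M
  for M :: "'a measure" +
  fixes X :: "int \<Rightarrow> 'a \<Rightarrow> real" and x :: real
  assumes X_measurable [measurable]: "\<And>k. X k \<in> borel_measurable M"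
    and X_square_integrable: "\<And>k. integrable M (\<lambda>\<omega>. (X k \<omega>)\<^sup>2)"
    and X_second_moment: "\<And>k. (LINT \<omega>|M. (X k \<omega>)\<^sup>2) = 1"
    and ratio: "x \<noteq> 0" "\<bar>x\<bar> < 1"
    and linear: "\<And>k. AE \<omega> in M. real_cond_exp M (sigma_others M X k) (X k) \<omega>
           = x / (1 + x\<^sup>2) * (X (k - 1) \<omega> + X (k + 1) \<omega>)"
begin

abbreviation past :: "int \<Rightarrow> 'a measure" where
  "past m \<equiv> sigma_indexed M X {..m}"

lemma X_integrable: "integrable M (X k)"
  by (rule square_integrable_imp_integrable[OF X_measurable X_square_integrable])

lemma XX_integrable: "integrable M (\<lambda>\<omega>. X j \<omega> * X k \<omega>)"
  by (intro integrable_product_of_squares X_measurable X_square_integrable)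

lemma subalgebra_past: "subalgebra M (past m)"
  by (intro subalgebra_sigma_indexed X_measurable)

lemma X_measurable_past: "j \<le> m \<Longrightarrow> X j \<in> borel_measurable (past m)"
  by (rule measurable_sigma_indexed) simp

text \<open>For \<open>m < k\<close> the past up to \<open>m\<close> is coarser than the sigma-field of all variables other than
  \<open>X\<^sub>k\<close>, so two-sided regressions can be substituted under one-sided conditional
  expectations, even when multiplied by another variable of the sequence.\<close>

lemma past_from_others:
  assumes "m < k" and j: "j \<noteq> k" and [measurable]: "Z \<in> borel_measurable M" "g \<in> borel_measurable M"
    and g: "AE \<omega> in M. real_cond_exp M (sigma_others M X k) Z \<omega> = g \<omega>"
  shows "integrable M Z \<Longrightarrow> AE \<omega> in M. real_cond_exp M (past m) Z \<omega> = real_cond_exp M (past m) g \<omega>"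
    and "integrable M (\<lambda>\<omega>. X j \<omega> * Z \<omega>) \<Longrightarrow> AE \<omega> in M. real_cond_exp M (past m) (\<lambda>\<omega>. X j \<omega> * Z \<omega>) \<omega>
           = real_cond_exp M (past m) (\<lambda>\<omega>. X j \<omega> * g \<omega>) \<omega>"
proof -
  have sub: "subalgebra M (sigma_others M X k)" "subalgebra (sigma_others M X k) (past m)"
    unfolding sigma_others_eq using assms(1)
    by (auto intro!: subalgebra_sigma_indexed subalgebra_sigma_indexed_mono)
  show "AE \<omega> in M. real_cond_exp M (past m) Z \<omega> = real_cond_exp M (past m) g \<omega>" if "integrable M Z"
    using real_cond_exp_tower_pull_out[OF sub, of "\<lambda>_. 1" Z g] that g by simp
  have "X j \<in> borel_measurable (sigma_others M X k)"
    unfolding sigma_others_eq using j by (intro measurable_sigma_indexed) auto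
  then show "AE \<omega> in M. real_cond_exp M (past m) (\<lambda>\<omega>. X j \<omega> * Z \<omega>) \<omega>
           = real_cond_exp M (past m) (\<lambda>\<omega>. X j \<omega> * g \<omega>) \<omega>" if "integrable M (\<lambda>\<omega>. X j \<omega> * Z \<omega>)"
    using real_cond_exp_tower_pull_out[OF sub, of "X j" Z g] that g by simp
qed

text \<open>The best predictions of \<open>X\<^bsub>m+k\<^esub>\<close> from the past form an \<open>L\<^sub>1\<close>-bounded solution of the
  recurrence that starts at \<open>X\<^sub>m\<close>, so they decay geometrically.\<close>

lemma one_sided_regression:
  shows one_step: "AE \<omega> in M. real_cond_exp M (past m) (X (m + 1)) \<omega> = x * X m \<omega>"
    and two_step: "AE \<omega> in M. real_cond_exp M (past m) (X (m + 2)) \<omega> = x\<^sup>2 * X m \<omega>"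
proof -
  interpret F: sigma_finite_subalgebra M "past m"
    by (rule sigma_finite_subalgebraI[OF subalgebra_past])
  let ?Y = "\<lambda>k::nat. real_cond_exp M (past m) (X (m + int k))"
  have int: "integrable M (?Y k)" for k
    by (rule F.real_cond_exp_int(1)[OF X_integrable])
  have K: "(LINT \<omega>|M. \<bar>?Y k \<omega>\<bar>) \<le> 2" for k
  proof -
    have "(LINT \<omega>|M. \<bar>?Y k \<omega>\<bar>) \<le> (LINT \<omega>|M. \<bar>X (m + int k) \<omega>\<bar>)"
      by (rule integral_abs_real_cond_exp_le[OF subalgebra_past X_integrable])
    also have "\<dots> \<le> (LINT \<omega>|M. 1 + (X (m + int k) \<omega>)\<^sup>2)"
    proof (rule integral_mono)
      show "\<bar>X (m + int k) \<omega>\<bar> \<le> 1 + (X (m + int k) \<omega>)\<^sup>2" for \<omega>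
      proof -
        have "0 \<le> (\<bar>X (m + int k) \<omega>\<bar> - 1)\<^sup>2" by simp
        then show ?thesis by (simp add: power2_diff)
      qed
    qed (use X_integrable X_square_integrable in auto)
    also have "\<dots> = 2"
      using X_square_integrable X_second_moment by (simp add: prob_space)
    finally show ?thesis .
  qed
  have rec: "AE \<omega> in M. ?Y (Suc k) \<omega> = x / (1 + x\<^sup>2) * (?Y k \<omega> + ?Y (Suc (Suc k)) \<omega>)" for k
  proof -
    have "AE \<omega> in M. ?Y (Suc k) \<omega> = real_cond_exp M (past m)
        (\<lambda>\<omega>. x / (1 + x\<^sup>2) * (X (m + int k) \<omega> + X (m + int (Suc (Suc k))) \<omega>)) \<omega>"
      by (rule past_from_others(1)[where k = "m + int (Suc k)" and j = m])
         (use linear[of "m + int (Suc k)"] X_integrable in \<open>auto simp: algebra_simps\<close>)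
    moreover have "AE \<omega> in M. real_cond_exp M (past m)
        (\<lambda>\<omega>. x / (1 + x\<^sup>2) * (X (m + int k) \<omega> + X (m + int (Suc (Suc k))) \<omega>)) \<omega>
        = x / (1 + x\<^sup>2) * real_cond_exp M (past m) (\<lambda>\<omega>. X (m + int k) \<omega> + X (m + int (Suc (Suc k))) \<omega>) \<omega>"
      using X_integrable by (intro F.real_cond_exp_cmult) auto
    moreover have "AE \<omega> in M. real_cond_exp M (past m) (\<lambda>\<omega>. X (m + int k) \<omega> + X (m + int (Suc (Suc k))) \<omega>) \<omega>
        = ?Y k \<omega> + ?Y (Suc (Suc k)) \<omega>"
      using X_integrable by (intro F.real_cond_exp_add) auto
    ultimately show ?thesis by eventually_elim simp
  qed
  have Y0: "AE \<omega> in M. ?Y 0 \<omega> = X m \<omega>"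
    using X_integrable X_measurable_past by simp
  have Y1: "AE \<omega> in M. ?Y 1 \<omega> = x * ?Y 0 \<omega>"
    by (rule L1_bounded_recurrence[where Y = ?Y, OF ratio int K rec])
  from Y0 Y1 show "AE \<omega> in M. real_cond_exp M (past m) (X (m + 1)) \<omega> = x * X m \<omega>"
    by eventually_elim simp
  have "1 + x\<^sup>2 \<noteq> 0" by (simp add: add_nonneg_eq_0_iff)
  from Y0 Y1 rec[of 0] show "AE \<omega> in M. real_cond_exp M (past m) (X (m + 2)) \<omega> = x\<^sup>2 * X m \<omega>"
  proof eventually_elim
    case (elim \<omega>)
    have "(1 + x\<^sup>2) * ?Y 1 \<omega> = x * (?Y 0 \<omega> + ?Y 2 \<omega>)"
      using elim(3) \<open>1 + x\<^sup>2 \<noteq> 0\<close> by (simp add: numeral_2_eq_2)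
    then have "x * ?Y 2 \<omega> = (1 + x\<^sup>2) * (x * X m \<omega>) - x * X m \<omega>"
      unfolding elim(1,2) by (simp only: distrib_left)
    also have "\<dots> = x * (x\<^sup>2 * X m \<omega>)"
      by (simp only: distrib_right) (simp add: mult_ac)
    finally have "?Y 2 \<omega> = x\<^sup>2 * X m \<omega>"
      using ratio(1) by (metis mult_left_cancel)
    then show ?case by simp
  qed
qed

text \<open>This identifies the ratio \<open>x\<close> with the correlation of neighbours.\<close>

lemma lag_one_moment: "(LINT \<omega>|M. X m \<omega> * X (m + 1) \<omega>) = x"
proof -
  interpret F: sigma_finite_subalgebra M "past m"
    by (rule sigma_finite_subalgebraI[OF subalgebra_past])
  have "(LINT \<omega>|M. X m \<omega> * X (m + 1) \<omega>)
      = (LINT \<omega>|M. X m \<omega> * real_cond_exp M (past m) (X (m + 1)) \<omega>)"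
    by (rule F.real_cond_exp_intg(2)[symmetric]) (auto intro: XX_integrable X_measurable_past)
  also have "\<dots> = (LINT \<omega>|M. x * (X m \<omega>)\<^sup>2)"
    using one_step[of m] by (intro integral_cong_AE) (auto simp: power2_eq_square)
  also have "\<dots> = x" by (simp add: X_second_moment)
  finally show ?thesis .
qed

text \<open>The identity compares two evaluations of \<open>E\<^sub>m (X\<^bsub>m+1\<^esub> X\<^bsub>m+2\<^esub>)\<close>. Predicting \<open>X\<^bsub>m+2\<^esub>\<close>
  from \<open>X\<^bsub>m+1\<^esub>\<close> gives \<open>x E\<^sub>m X\<^bsub>m+1\<^esub>\<^sup>2\<close>; interpolating \<open>X\<^bsub>m+1\<^esub>\<close> between \<open>X\<^sub>m\<close> and
  \<open>X\<^bsub>m+2\<^esub>\<close> gives \<open>x / (1 + x\<^sup>2) (x\<^sup>2 X\<^sub>m\<^sup>2 + E\<^sub>m X\<^bsub>m+2\<^esub>\<^sup>2)\<close>. The second moment at distance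
  two can thus be eliminated from the quadratic regression.\<close>

lemma second_moment_two_step:
  "AE \<omega> in M. real_cond_exp M (past m) (\<lambda>\<omega>. (X (m + 2) \<omega>)\<^sup>2) \<omega>
     = (1 + x\<^sup>2) * real_cond_exp M (past m) (\<lambda>\<omega>. (X (m + 1) \<omega>)\<^sup>2) \<omega> - x\<^sup>2 * (X m \<omega>)\<^sup>2"
proof -
  let ?E = "real_cond_exp M (past m)"
  let ?a = "x / (1 + x\<^sup>2)"
  interpret F: sigma_finite_subalgebra M "past m"
    by (rule sigma_finite_subalgebraI[OF subalgebra_past])
  have comm: "(\<lambda>\<omega>. X (m + 2) \<omega> * X (m + 1) \<omega>) = (\<lambda>\<omega>. X (m + 1) \<omega> * X (m + 2) \<omega>)"
    by (simp add: mult.commute)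
  have square: "(\<lambda>\<omega>. X (m + 1) \<omega> * (x * X (m + 1) \<omega>)) = (\<lambda>\<omega>. x * (X (m + 1) \<omega>)\<^sup>2)"
    by (simp add: power2_eq_square mult_ac)
  have "AE \<omega> in M. ?E (\<lambda>\<omega>. X (m + 1) \<omega> * X (m + 2) \<omega>) \<omega> = ?E (\<lambda>\<omega>. X (m + 1) \<omega> * (x * X (m + 1) \<omega>)) \<omega>"
    by (rule real_cond_exp_tower_pull_out[where H = "past (m + 1)"])
       (use one_step[of "m + 1"] in \<open>auto intro!: subalgebra_past subalgebra_sigma_indexed_mono
          X_measurable_past XX_integrable simp: add.assoc\<close>)
  moreover have "AE \<omega> in M. ?E (\<lambda>\<omega>. x * (X (m + 1) \<omega>)\<^sup>2) \<omega> = x * ?E (\<lambda>\<omega>. (X (m + 1) \<omega>)\<^sup>2) \<omega>"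
    by (rule F.real_cond_exp_cmult[OF X_square_integrable])
  ultimately have forward: "AE \<omega> in M. ?E (\<lambda>\<omega>. X (m + 1) \<omega> * X (m + 2) \<omega>) \<omega>
      = x * ?E (\<lambda>\<omega>. (X (m + 1) \<omega>)\<^sup>2) \<omega>"
    unfolding square by auto
  have "AE \<omega> in M. ?E (\<lambda>\<omega>. X (m + 2) \<omega> * X (m + 1) \<omega>) \<omega>
      = ?E (\<lambda>\<omega>. X (m + 2) \<omega> * (?a * (X m \<omega> + X (m + 2) \<omega>))) \<omega>"
    by (rule past_from_others(2)[where k = "m + 1"])
       (use linear[of "m + 1"] in \<open>auto intro!: XX_integrable simp: add.assoc\<close>)
  moreover have "(\<lambda>\<omega>. X (m + 2) \<omega> * (?a * (X m \<omega> + X (m + 2) \<omega>)))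
      = (\<lambda>\<omega>. 0 + ((?a * X m \<omega>) * X (m + 2) \<omega> + ?a * (X (m + 2) \<omega>)\<^sup>2))"
    by (simp add: algebra_simps power2_eq_square)
  moreover have "AE \<omega> in M. ?E (\<lambda>\<omega>. 0 + ((?a * X m \<omega>) * X (m + 2) \<omega> + ?a * (X (m + 2) \<omega>)\<^sup>2)) \<omega>
      = 0 + ((?a * X m \<omega>) * ?E (X (m + 2)) \<omega> + ?a * ?E (\<lambda>\<omega>. (X (m + 2) \<omega>)\<^sup>2) \<omega>)"
    by (rule real_cond_exp_quadratic)
       (use X_measurable_past[of m m] XX_integrable[of m "m + 2"] in
        \<open>auto intro!: subalgebra_past X_square_integrable borel_measurable_times simp: mult.assoc\<close>)
  ultimately have "AE \<omega> in M. ?E (\<lambda>\<omega>. X (m + 1) \<omega> * X (m + 2) \<omega>) \<omega>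
      = ?a * X m \<omega> * ?E (X (m + 2)) \<omega> + ?a * ?E (\<lambda>\<omega>. (X (m + 2) \<omega>)\<^sup>2) \<omega>"
    by (simp only: comm add_0_left) auto
  with forward two_step[of m] show ?thesis
  proof eventually_elim
    case (elim \<omega>)
    have "1 + x\<^sup>2 \<noteq> 0" by (simp add: add_nonneg_eq_0_iff)
    have "x * ?E (\<lambda>\<omega>. (X (m + 1) \<omega>)\<^sup>2) \<omega>
        = ?a * (x\<^sup>2 * (X m \<omega>)\<^sup>2 + ?E (\<lambda>\<omega>. (X (m + 2) \<omega>)\<^sup>2) \<omega>)"
      using elim by (simp add: algebra_simps power2_eq_square)
    then have "x * ((1 + x\<^sup>2) * ?E (\<lambda>\<omega>. (X (m + 1) \<omega>)\<^sup>2) \<omega>)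
        = x * (x\<^sup>2 * (X m \<omega>)\<^sup>2 + ?E (\<lambda>\<omega>. (X (m + 2) \<omega>)\<^sup>2) \<omega>)"
      using \<open>1 + x\<^sup>2 \<noteq> 0\<close> by (simp add: field_simps)
    then show ?case using ratio by simp
  qed
qed

text \<open>The conditional variance of \<open>X\<^bsub>m+1\<^esub>\<close> given the past is nonnegative, and its conditional
  mean is \<open>x X\<^sub>m\<close>.\<close>

lemma second_moment_ge_square_of_regression:
  "AE \<omega> in M. x\<^sup>2 * (X m \<omega>)\<^sup>2 \<le> real_cond_exp M (past m) (\<lambda>\<omega>. (X (m + 1) \<omega>)\<^sup>2) \<omega>"
proof -
  let ?E = "real_cond_exp M (past m)"
  interpret F: sigma_finite_subalgebra M "past m"
    by (rule sigma_finite_subalgebraI[OF subalgebra_past])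
  let ?q = "\<lambda>\<omega>. x\<^sup>2 * (X m \<omega>)\<^sup>2 + ((- 2 * x * X m \<omega>) * X (m + 1) \<omega> + 1 * (X (m + 1) \<omega>)\<^sup>2)"
  have "?q \<omega> = (X (m + 1) \<omega> - x * X m \<omega>)\<^sup>2" for \<omega>
    by (simp add: power2_eq_square algebra_simps)
  then have "0 \<le> ?q \<omega>" for \<omega>
    using zero_le_power2 by metis
  then have "AE \<omega> in M. 0 \<le> ?E ?q \<omega>"
    by (intro F.real_cond_exp_pos AE_I2) measurable
  moreover have "AE \<omega> in M. ?E ?q \<omega> = x\<^sup>2 * (X m \<omega>)\<^sup>2
      + ((- 2 * x * X m \<omega>) * ?E (X (m + 1)) \<omega> + 1 * ?E (\<lambda>\<omega>. (X (m + 1) \<omega>)\<^sup>2) \<omega>)"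
    by (rule real_cond_exp_quadratic)
       (use X_measurable_past[of m m] XX_integrable[of m "m + 1"] in
        \<open>auto intro!: subalgebra_past X_square_integrable borel_measurable_times borel_measurable_power
           simp: mult.assoc\<close>)
  ultimately show ?thesis
    using one_step[of m]
  proof eventually_elim
    case (elim \<omega>)
    then show ?case by (simp add: power2_eq_square algebra_simps)
  qed
qed

text \<open>Conditioning the quadratic regression at \<open>m + 1\<close> on the past and eliminating the second moment
  of \<open>X\<^bsub>m+2\<^esub>\<close> determines the conditional second moment of \<open>X\<^bsub>m+1\<^esub>\<close>, up to the factor
  \<open>1 - A (1 + x\<^sup>2)\<close>. The bound on \<open>A\<close> makes this factor positive, and the inequality is then
  nonnegativity of the conditional variance, multiplied by it.\<close>

lemma quadratic_constraint:
  assumes quadratic: "\<And>k. AE \<omega> in M. real_cond_exp M (sigma_others M X k) (\<lambda>\<omega>'. (X k \<omega>')\<^sup>2) \<omega>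
           = A * ((X (k - 1) \<omega>)\<^sup>2 + (X (k + 1) \<omega>)\<^sup>2) + B * X (k - 1) \<omega> * X (k + 1) \<omega>
             + C + D * (X (k - 1) \<omega> + X (k + 1) \<omega>)"
    and A: "A < 1 / (1 + x\<^sup>2)"
  shows "AE \<omega> in M. 0 \<le> x\<^sup>2 * (A * (x\<^sup>2 + 1 / x\<^sup>2) + B - 1) * (X m \<omega>)\<^sup>2 + D * (1 + x\<^sup>2) * X m \<omega> + C"
proof -
  let ?E = "real_cond_exp M (past m)"
  let ?U = "\<lambda>\<omega>. A * (X m \<omega>)\<^sup>2 + C + D * X m \<omega>"
  let ?V = "\<lambda>\<omega>. B * X m \<omega> + D"
  have meas: "?U \<in> borel_measurable (past m)" "?V \<in> borel_measurable (past m)"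
    using X_measurable_past[of m m] by measurable
  have "AE \<omega> in M. real_cond_exp M (sigma_others M X (m + 1)) (\<lambda>\<omega>. (X (m + 1) \<omega>)\<^sup>2) \<omega>
      = ?U \<omega> + (?V \<omega> * X (m + 2) \<omega> + A * (X (m + 2) \<omega>)\<^sup>2)"
    using quadratic[of "m + 1"] by eventually_elim (simp add: algebra_simps)
  then have "AE \<omega> in M. ?E (\<lambda>\<omega>. (X (m + 1) \<omega>)\<^sup>2) \<omega>
      = ?E (\<lambda>\<omega>. ?U \<omega> + (?V \<omega> * X (m + 2) \<omega> + A * (X (m + 2) \<omega>)\<^sup>2)) \<omega>"
    by (intro past_from_others(1)[where k = "m + 1" and j = m]) (auto intro: X_square_integrable)
  moreover have "AE \<omega> in M. ?E (\<lambda>\<omega>. ?U \<omega> + (?V \<omega> * X (m + 2) \<omega> + A * (X (m + 2) \<omega>)\<^sup>2)) \<omega>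
      = ?U \<omega> + (?V \<omega> * ?E (X (m + 2)) \<omega> + A * ?E (\<lambda>\<omega>. (X (m + 2) \<omega>)\<^sup>2) \<omega>)"
    by (rule real_cond_exp_quadratic[OF subalgebra_past meas(1) _ meas(2)])
       (use XX_integrable[of m "m + 2"] X_integrable X_square_integrable in
        \<open>auto simp: distrib_right mult.assoc\<close>)
  ultimately show ?thesis
    using second_moment_two_step[of m] two_step[of m] second_moment_ge_square_of_regression[of m]
  proof eventually_elim
    case (elim \<omega>)
    let ?u = "?E (\<lambda>\<omega>. (X (m + 1) \<omega>)\<^sup>2) \<omega>" and ?y = "X m \<omega>"
    have "?u = ?U \<omega> + (?V \<omega> * (x\<^sup>2 * ?y) + A * ((1 + x\<^sup>2) * ?u - x\<^sup>2 * ?y\<^sup>2))"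
      using elim by simp
    then have u: "(1 - A * (1 + x\<^sup>2)) * ?u
        = (A * (1 - x\<^sup>2) + B * x\<^sup>2) * ?y\<^sup>2 + D * (1 + x\<^sup>2) * ?y + C"
      by (simp add: algebra_simps power2_eq_square)
    have "1 + x\<^sup>2 > 0" by (simp add: add_pos_nonneg)
    then have "1 - A * (1 + x\<^sup>2) \<ge> 0" using A by (simp add: field_simps)
    then have "(1 - A * (1 + x\<^sup>2)) * (x\<^sup>2 * ?y\<^sup>2) \<le> (1 - A * (1 + x\<^sup>2)) * ?u"
      using elim(5) by (rule mult_left_mono[rotated])
    moreover have "x\<^sup>2 * (A * (x\<^sup>2 + 1 / x\<^sup>2) + B - 1)
        = (A * (1 - x\<^sup>2) + B * x\<^sup>2) - (1 - A * (1 + x\<^sup>2)) * x\<^sup>2"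
      using ratio by (simp add: field_simps power2_eq_square)
    ultimately show ?case unfolding u by (simp add: algebra_simps)
  qed
qed

end

section \<open>Boundedness\<close>

text \<open>Once \<open>\<bar>y\<bar> > 1\<close>, the lower-order part is at most \<open>(\<bar>d\<bar> + \<bar>e\<bar>) \<bar>y\<bar>\<close>, which
  \<open>- c y\<^sup>2\<close> overtakes as \<open>\<bar>y\<bar>\<close> grows.\<close>

lemma abs_bound_if_concave_quadratic_nonneg:
  fixes c d e y :: real
  assumes "c < 0" and "0 \<le> c * y\<^sup>2 + d * y + e"
  shows "\<bar>y\<bar> \<le> 1 + (\<bar>d\<bar> + \<bar>e\<bar>) / - c"
proof (cases "\<bar>y\<bar> \<le> 1")
  case True
  have "0 \<le> (\<bar>d\<bar> + \<bar>e\<bar>) / - c" using assms by (intro divide_nonneg_pos) auto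
  with True show ?thesis by linarith
next
  case False
  have "- c * \<bar>y\<bar> * \<bar>y\<bar> \<le> d * y + e" using assms(2) by (simp add: power2_eq_square)
  also have "\<dots> \<le> \<bar>d\<bar> * \<bar>y\<bar> + \<bar>e\<bar> * \<bar>y\<bar>"
  proof (rule add_mono)
    show "d * y \<le> \<bar>d\<bar> * \<bar>y\<bar>" by (metis abs_ge_self abs_mult)
    have "\<bar>e\<bar> * 1 \<le> \<bar>e\<bar> * \<bar>y\<bar>" using False by (intro mult_left_mono) auto
    then show "e \<le> \<bar>e\<bar> * \<bar>y\<bar>" by linarith
  qed
  finally have "(- c * \<bar>y\<bar>) * \<bar>y\<bar> \<le> (\<bar>d\<bar> + \<bar>e\<bar>) * \<bar>y\<bar>" by (simp add: algebra_simps)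
  then have "- c * \<bar>y\<bar> \<le> \<bar>d\<bar> + \<bar>e\<bar>"
    using False by (subst (asm) mult_le_cancel_right_pos) auto
  then have "\<bar>y\<bar> \<le> (\<bar>d\<bar> + \<bar>e\<bar>) / - c" using assms(1) by (simp add: field_simps)
  then show ?thesis by simp
qed

theorem proposition3p1:
  fixes M :: "'a measure"
    and X :: "int \<Rightarrow> 'a \<Rightarrow> real"
    and \<rho> r2 a b A B C D :: real
  assumes "prob_space M"
    and "L2_stationary M X"
    and "\<And>k. (LINT \<omega>|M. X k \<omega>) = 0"
    and "\<And>k. (LINT \<omega>|M. (X k \<omega>)\<^sup>2) = 1"
    and "\<rho> = correlation M (X 0) (X 1)"
    and "r2 = correlation M (X 0) (X 2)"
    and "\<rho> \<noteq> 0"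
    and "r2 + 1 - 2 * \<bar>\<rho>\<bar> > 0"
    and "\<And>k. AE \<omega> in M. real_cond_exp M (sigma_others M X k) (X k) \<omega>
           = a * (X (k - 1) \<omega> + X (k + 1) \<omega>) + b"
    and "\<And>k. AE \<omega> in M. real_cond_exp M (sigma_others M X k) (\<lambda>\<omega>'. (X k \<omega>')\<^sup>2) \<omega>
           = A * ((X (k - 1) \<omega>)\<^sup>2 + (X (k + 1) \<omega>)\<^sup>2) + B * X (k - 1) \<omega> * X (k + 1) \<omega>
             + C + D * (X (k - 1) \<omega> + X (k + 1) \<omega>)"
    and "A < 1 / (1 + \<rho>\<^sup>2)"
  shows "(A * (\<rho>\<^sup>2 + 1 / \<rho>\<^sup>2) + B < 1 \<longrightarrow> AE_bounded M (X 0)) \<and>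
         (A * (\<rho>\<^sup>2 + 1 / \<rho>\<^sup>2) + B = 1 \<and> D \<noteq> 0 \<longrightarrow>
            (D > 0 \<longrightarrow> AE_bounded_below M (X 0)) \<and> (D < 0 \<longrightarrow> AE_bounded_above M (X 0)))"
proof -
  interpret prob_space M by fact
  have meas [measurable]: "X k \<in> borel_measurable M" and sq: "integrable M (\<lambda>\<omega>. (X k \<omega>)\<^sup>2)" for k
    using assms(2) by (auto simp: L2_stationary_def)
  have int: "integrable M (X k)" for k
    by (rule square_integrable_imp_integrable[OF meas sq])
  have prod_int: "integrable M (\<lambda>\<omega>. X j \<omega> * X k \<omega>)" for j k
    by (intro integrable_product_of_squares meas sq)
  have corr: "correlation M (X j) (X k) = (LINT \<omega>|M. X j \<omega> * X k \<omega>)" for j k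
    using assms(3,4) by (simp add: correlation_def covariance_def power2_eq_square)
  have "subalgebra M (sigma_others M X 1)"
    unfolding sigma_others_eq by (intro subalgebra_sigma_indexed meas)
  then interpret G: sigma_finite_subalgebra M "sigma_others M X 1"
    by (rule sigma_finite_subalgebraI)

  \<comment> \<open>taking means in the linear regression kills the intercept\<close>
  have "(LINT \<omega>|M. X 1 \<omega>) = (LINT \<omega>|M. real_cond_exp M (sigma_others M X 1) (X 1) \<omega>)"
    using G.real_cond_exp_int(2)[OF int] by simp
  also have "\<dots> = (LINT \<omega>|M. a * (X 0 \<omega> + X 2 \<omega>) + b)"
    using assms(9)[of 1] by (intro integral_cong_AE) auto
  also have "\<dots> = b"
    using assms(3) int by (simp add: prob_space)
  finally have b: "b = 0" using assms(3) by simp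

  \<comment> \<open>testing the regression of \<open>X 1\<close> against \<open>X 0\<close> relates its coefficient to the correlations\<close>
  have X0: "X 0 \<in> borel_measurable (sigma_others M X 1)"
    unfolding sigma_others_eq by (rule measurable_sigma_indexed) simp
  have "\<rho> = (LINT \<omega>|M. X 0 \<omega> * real_cond_exp M (sigma_others M X 1) (X 1) \<omega>)"
    unfolding assms(5) corr by (rule G.real_cond_exp_intg(2)[symmetric, OF prod_int X0]) simp
  also have "\<dots> = (LINT \<omega>|M. a * ((X 0 \<omega>)\<^sup>2 + X 0 \<omega> * X 2 \<omega>))"
    using assms(9)[of 1] b by (intro integral_cong_AE) (auto simp: algebra_simps power2_eq_square)
  also have "\<dots> = a * (1 + r2)"
    using assms(4) sq prod_int by (simp add: assms(6) corr)
  finally have \<rho>_eq: "\<rho> = a * (1 + r2)" .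

  have pos: "1 + r2 > 0" using assms(8) abs_ge_zero[of \<rho>] by linarith
  have "\<bar>a\<bar> = \<bar>\<rho>\<bar> / (1 + r2)"
    using pos by (simp add: \<rho>_eq abs_mult)
  also have "\<dots> < 1 / 2"
    using pos assms(8) by (simp add: pos_divide_less_eq)
  finally have "\<bar>a\<bar> < 1 / 2" .
  moreover have "a \<noteq> 0" using assms(7) \<rho>_eq by auto
  ultimately obtain x where x: "x \<noteq> 0" "\<bar>x\<bar> < 1" "a = x / (1 + x\<^sup>2)"
    using small_root_exists by metis

  interpret two_sided_linear_regression M X x
    by unfold_locales (use meas sq assms(4) x assms(9) b in auto)
  have \<rho>: "\<rho> = x"
    using lag_one_moment[of 0] by (simp add: assms(5) corr)
  let ?c = "x\<^sup>2 * (A * (x\<^sup>2 + 1 / x\<^sup>2) + B - 1)" and ?d = "D * (1 + x\<^sup>2)"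
  have q: "AE \<omega> in M. 0 \<le> ?c * (X 0 \<omega>)\<^sup>2 + ?d * X 0 \<omega> + C"
    by (rule quadratic_constraint) (use assms(10,11) \<rho> in auto)
  have d: "1 + x\<^sup>2 > 0" by (simp add: add_pos_nonneg)

  show ?thesis
    unfolding \<rho>
  proof (intro conjI impI)
    assume "A * (x\<^sup>2 + 1 / x\<^sup>2) + B < 1"
    then have c: "?c < 0" using x by (intro mult_pos_neg) auto
    have "AE \<omega> in M. \<bar>X 0 \<omega>\<bar> \<le> 1 + (\<bar>?d\<bar> + \<bar>C\<bar>) / - ?c"
      using q by eventually_elim (rule abs_bound_if_concave_quadratic_nonneg[OF c])
    then show "AE_bounded M (X 0)" unfolding AE_bounded_def by blast
  next
    assume h: "A * (x\<^sup>2 + 1 / x\<^sup>2) + B = 1 \<and> D \<noteq> 0"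
    then have "?c = 0" by simp
    with q have lin: "AE \<omega> in M. 0 \<le> ?d * X 0 \<omega> + C" by simp
    { assume "D > 0"
      then have "?d > 0" using d by simp
      have "AE \<omega> in M. - C / ?d \<le> X 0 \<omega>"
        using lin
      proof eventually_elim
        case (elim \<omega>)
        then have "- C \<le> X 0 \<omega> * ?d" by (simp add: mult.commute)
        then show ?case by (simp only: pos_divide_le_eq[OF \<open>?d > 0\<close>])
      qed
      then show "AE_bounded_below M (X 0)" unfolding AE_bounded_below_def by blast }
    { assume "D < 0"
      then have "?d < 0" using d by (simp add: mult_neg_pos)
      have "AE \<omega> in M. X 0 \<omega> \<le> - C / ?d"
        using lin
      proof eventually_elim
        case (elim \<omega>)
        then have "- C \<le> X 0 \<omega> * ?d" by (simp add: mult.commute)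
        then show ?case by (simp only: neg_le_divide_eq[OF \<open>?d < 0\<close>])
      qed
      then show "AE_bounded_above M (X 0)" unfolding AE_bounded_above_def by blast }
  qed
qed

end
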